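(* Let $H_0,\dots,H_m\in\mathbb{R}^{n\times n}$ be symmetric matrices and let $G(\delta)=H_0+\sum_{i=1}^m\delta_iH_i$ for $\delta\in\mathbb{R}^m$. Suppose that the matrices $H_1,\dots,H_m$ are either all positive semidefinite or all negative semidefinite. Then $G(\delta)\ge 0$ for all $\delta$ in the unit cube $\{\delta\in\mathbb{R}^m\mid|\delta_i|\le 1\text{ for all } i\}$ if and only if there exists a tuple $(S_0,S_1,\dots,S_m)\in\mathcal{X}_3$.
   Context: $\mathcal{X}_3$ is the set of tuples $(S_0,S_1,\dots,S_m)$ such that: $S_0$ is a symmetric $n\times n$ polynomial matrix in $\delta=(\delta_1,\dots,\delta_m)$ of total degree at most $2$ which is sum-of-squares (there exist $q$ and a polynomial matrix $T\in\mathbb{R}[\delta]^{n\times q}$ with $S_0(\delta)=T(\delta)T(\delta)^T$); $S_1,\dots,S_m\in\mathbb{R}^{n\times n}$ are constant symmetric matrices; and, identically in $\delta$, $G(\delta)=S_0(\delta)+\sum_{i=1}^m(1-\delta_i^2)S_i$. For a symmetric matrix $X$, $X\ge 0$ means positive semidefinite. *)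

theory Defs
  imports "HOL-Analysis.Analysis" "HOL-Library.Poly_Mapping"
begin

definition psd :: "real ^ 'n ^ 'n \<Rightarrow> bool" where
  "psd A \<longleftrightarrow> transpose A = A \<and> (\<forall>x. 0 \<le> x \<bullet> (A *v x))"

definition nsd :: "real ^ 'n ^ 'n \<Rightarrow> bool" where
  "nsd A \<longleftrightarrow> transpose A = A \<and> (\<forall>x. x \<bullet> (A *v x) \<le> 0)"

definition unit_cube :: "(real ^ 'm) set" where
  "unit_cube = {\<delta>. \<forall>i. \<bar>\<delta> $ i\<bar> \<le> 1}"

text \<open>
  Real polynomials in the variables \<open>\<delta>\<^sub>i\<close>, indexed by the elements \<open>i\<close> of the finite type
  \<open>'m\<close>: a monomial is its exponent function \<open>'m \<Rightarrow>\<^sub>0 nat\<close>, and a polynomial maps each monomial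
  to its coefficient. Addition of exponents makes the library's convolution product on
  \<^typ>\<open>('m \<Rightarrow>\<^sub>0 nat) \<Rightarrow>\<^sub>0 real\<close> the product of polynomials.
\<close>

type_synonym 'm rpoly = "('m \<Rightarrow>\<^sub>0 nat) \<Rightarrow>\<^sub>0 real"

definition eval_rpoly :: "('m::finite) rpoly \<Rightarrow> real ^ 'm \<Rightarrow> real" where
  "eval_rpoly p \<delta> =
     (\<Sum>\<alpha>\<in>Poly_Mapping.keys p.
        Poly_Mapping.lookup p \<alpha> * (\<Prod>i\<in>UNIV. (\<delta> $ i) ^ Poly_Mapping.lookup \<alpha> i))"

definition total_degree_le :: "nat \<Rightarrow> ('m::finite) rpoly \<Rightarrow> bool" where
  "total_degree_le d p \<longleftrightarrow>
     (\<forall>\<alpha>\<in>Poly_Mapping.keys p. (\<Sum>i\<in>UNIV. Poly_Mapping.lookup \<alpha> i) \<le> d)"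

definition eval_pmat :: "('m::finite) rpoly ^ 'n ^ 'n \<Rightarrow> real ^ 'm \<Rightarrow> real ^ 'n ^ 'n" where
  "eval_pmat S \<delta> = (\<chi> i j. eval_rpoly (S $ i $ j) \<delta>)"

text \<open>
  \<open>S = T T\<^sup>T\<close> for some polynomial matrix \<open>T\<close> with \<open>q\<close> columns. As \<open>q\<close> is existentially quantified,
  the columns of \<open>T\<close> are indexed by the naturals below \<open>q\<close>.
\<close>

definition sos_pmat :: "('m::finite) rpoly ^ 'n ^ 'n \<Rightarrow> bool" where
  "sos_pmat S \<longleftrightarrow>
     (\<exists>(q::nat) (T :: 'n \<Rightarrow> nat \<Rightarrow> 'm rpoly). \<forall>i j. S $ i $ j = (\<Sum>k<q. T i k * T j k))"

definition affine_pencil ::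
    "real ^ 'n ^ 'n \<Rightarrow> ('m::finite \<Rightarrow> real ^ 'n ^ 'n) \<Rightarrow> real ^ 'm \<Rightarrow> real ^ 'n ^ 'n" where
  "affine_pencil H0 H \<delta> = H0 + (\<Sum>i\<in>UNIV. (\<delta> $ i) *\<^sub>R H i)"

text \<open>
  A tuple \<open>(S\<^sub>0, S\<^sub>1, \<dots>, S\<^sub>m)\<close> is the pair of \<open>S\<^sub>0\<close> and the family \<open>(S\<^sub>i)\<close>. The constant matrices \<open>S\<^sub>i\<close>
  are required to be symmetric only, not positive semidefinite.
\<close>

definition X3 ::
    "(real ^ ('m::finite) \<Rightarrow> real ^ 'n ^ 'n) \<Rightarrow> (('m rpoly ^ 'n ^ 'n) \<times> ('m \<Rightarrow> real ^ 'n ^ 'n)) set" where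
  "X3 G = {(S0, S).
     transpose S0 = S0 \<and>
     (\<forall>i j. total_degree_le 2 (S0 $ i $ j)) \<and>
     sos_pmat S0 \<and>
     (\<forall>i. transpose (S i) = S i) \<and>
     (\<forall>\<delta>. G \<delta> = eval_pmat S0 \<delta> + (\<Sum>i\<in>UNIV. (1 - (\<delta> $ i)\<^sup>2) *\<^sub>R S i))}"

end

theory Submission
  imports Defs
begin

text \<open>
  Put \<open>s = 1\<close> if all \<open>H\<^sub>i\<close> are positive semidefinite and \<open>s = - 1\<close> if all are negative semidefinite, so
  that every \<open>s H\<^sub>i\<close> is positive semidefinite. On the cube \<open>G\<close> is smallest at the vertex
  \<open>v = (- s, \<dots>, - s)\<close>, where \<open>1 - \<delta>\<^sub>i\<^sup>2 = 0\<close> and hence \<open>G(v) = S\<^sub>0(v) \<ge> 0\<close>. Conversely, if \<open>G(v) \<ge> 0\<close> then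
  \<open>1 + s \<delta>\<^sub>i = (1 + s \<delta>\<^sub>i)\<^sup>2 / 2 + (1 - \<delta>\<^sub>i\<^sup>2) / 2\<close> turns
  \<open>G(\<delta>) = G(v) + \<Sum>\<^sub>i (1 + s \<delta>\<^sub>i) s H\<^sub>i\<close> into a certificate with \<open>S\<^sub>i = s H\<^sub>i / 2\<close>.
\<close>

section \<open>Evaluation and degree of polynomials\<close>

text \<open>Extra monomials have coefficient 0. Polynomials with different supports can thus be
  summed over a common index set, even if cancellation shrinks the support of \<open>p + q\<close>
  or the coefficient of a \<open>single\<close> is 0.\<close>

lemma eval_rpoly_superset:
  assumes "finite A" "Poly_Mapping.keys p \<subseteq> A"
  shows "eval_rpoly p \<delta> =
    (\<Sum>\<alpha>\<in>A. Poly_Mapping.lookup p \<alpha> * (\<Prod>i\<in>UNIV. (\<delta> $ i) ^ Poly_Mapping.lookup \<alpha> i))"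
  unfolding eval_rpoly_def using assms
  by (intro sum.mono_neutral_left) (auto simp: in_keys_iff)

lemma eval_rpoly_zero [simp]: "eval_rpoly 0 \<delta> = 0"
  by (simp add: eval_rpoly_def)

lemma eval_rpoly_add: "eval_rpoly (p + q) \<delta> = eval_rpoly p \<delta> + eval_rpoly q \<delta>"
proof -
  let ?A = "Poly_Mapping.keys p \<union> Poly_Mapping.keys q"
  have "Poly_Mapping.keys (p + q) \<subseteq> ?A"
    by (rule Poly_Mapping.keys_add)
  then show ?thesis
    by (simp add: eval_rpoly_superset [of ?A] lookup_add distrib_right sum.distrib)
qed

lemma eval_rpoly_sum: "eval_rpoly (\<Sum>k\<in>A. f k) \<delta> = (\<Sum>k\<in>A. eval_rpoly (f k) \<delta>)"
  by (induction A rule: infinite_finite_induct) (auto simp: eval_rpoly_add)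

lemma eval_rpoly_single [simp]:
  "eval_rpoly (Poly_Mapping.single \<alpha> c) \<delta> = c * (\<Prod>i\<in>UNIV. (\<delta> $ i) ^ Poly_Mapping.lookup \<alpha> i)"
  by (subst eval_rpoly_superset [of "{\<alpha>}"]) auto

lemma rpoly_as_sum_single:
  "p = (\<Sum>\<alpha>\<in>Poly_Mapping.keys p. Poly_Mapping.single \<alpha> (Poly_Mapping.lookup p \<alpha>))"
  by (rule poly_mapping_eqI)
    (simp add: lookup_sum lookup_single when_def sum.delta in_keys_iff)

text \<open>Both sides are bilinear in \<open>p\<close> and \<open>q\<close>, so it suffices to
  compare them on monomials, where exponents add.\<close>

lemma eval_rpoly_mult: "eval_rpoly (p * q) \<delta> = eval_rpoly p \<delta> * eval_rpoly q \<delta>"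
proof -
  have single: "eval_rpoly (Poly_Mapping.single \<alpha> a * Poly_Mapping.single \<beta> b) \<delta> =
      eval_rpoly (Poly_Mapping.single \<alpha> a) \<delta> * eval_rpoly (Poly_Mapping.single \<beta> b) \<delta>" for \<alpha> \<beta> a b
    by (simp add: mult_single lookup_add power_add prod.distrib)
  \<comment> \<open>The opaque \<open>A\<close>, \<open>B\<close>, \<open>f\<close>,
    \<open>g\<close> keep \<open>p\<close> and \<open>q\<close> out of the right-hand sides, so that
    rewriting with these equations terminates.\<close>
  obtain A B f g where "p = (\<Sum>\<alpha>\<in>A. Poly_Mapping.single \<alpha> (f \<alpha>))"
      "q = (\<Sum>\<beta>\<in>B. Poly_Mapping.single \<beta> (g \<beta>))"
    using rpoly_as_sum_single by metis
  then show ?thesis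
    by (simp only: sum_product eval_rpoly_sum single)
qed

lemma total_degree_le_zero [simp]: "total_degree_le d 0"
  by (simp add: total_degree_le_def)

lemma total_degree_le_add:
  "total_degree_le d p \<Longrightarrow> total_degree_le d q \<Longrightarrow> total_degree_le d (p + q)"
  using Poly_Mapping.keys_add [of p q] by (auto simp: total_degree_le_def)

lemma total_degree_le_sum:
  "(\<And>k. k \<in> A \<Longrightarrow> total_degree_le d (f k)) \<Longrightarrow> total_degree_le d (\<Sum>k\<in>A. f k)"
  by (induction A rule: infinite_finite_induct) (auto simp: total_degree_le_add)

lemma total_degree_le_mult:
  "total_degree_le d p \<Longrightarrow> total_degree_le e q \<Longrightarrow> total_degree_le (d + e) (p * q)"
  using keys_mult [of p q]
  by (fastforce simp: total_degree_le_def lookup_add sum.distrib intro: add_mono)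

definition const_rpoly :: "real \<Rightarrow> ('m::finite) rpoly" where
  "const_rpoly c = Poly_Mapping.single 0 c"

definition var_rpoly :: "'m \<Rightarrow> ('m::finite) rpoly" where
  "var_rpoly i = Poly_Mapping.single (Poly_Mapping.single i 1) 1"

lemma eval_const_rpoly [simp]: "eval_rpoly (const_rpoly c) \<delta> = c"
  by (simp add: const_rpoly_def)

lemma eval_var_rpoly [simp]: "eval_rpoly (var_rpoly i) \<delta> = \<delta> $ i"
proof -
  have "(\<delta> $ k) ^ (1 when i = k) = (if k = i then \<delta> $ k else 1)" for k
    by (auto simp: when_def)
  then show ?thesis
    by (simp add: var_rpoly_def lookup_single)
qed

lemma total_degree_le_const_rpoly: "total_degree_le d (const_rpoly c)"
  by (auto simp: const_rpoly_def total_degree_le_def split: if_splits)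

lemma total_degree_le_var_rpoly: "total_degree_le 1 (var_rpoly i)"
  by (simp add: var_rpoly_def total_degree_le_def lookup_single when_def)

lemma const_rpoly_add: "const_rpoly (a + b) = const_rpoly a + const_rpoly b"
  by (simp add: const_rpoly_def single_add)

lemma const_rpoly_mult: "const_rpoly (a * b) = const_rpoly a * const_rpoly b"
  by (simp add: const_rpoly_def mult_single)

lemma const_rpoly_sum: "const_rpoly (\<Sum>k\<in>A. f k) = (\<Sum>k\<in>A. const_rpoly (f k))"
  by (induction A rule: infinite_finite_induct) (auto simp: const_rpoly_add, auto simp: const_rpoly_def)

section \<open>Positive semidefinite matrices\<close>

lemma psd_add: "psd A \<Longrightarrow> psd B \<Longrightarrow> psd (A + B)"
  by (auto simp: psd_def transpose_def vec_eq_iff matrix_vector_mult_add_rdistrib inner_add_right)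

lemma psd_zero: "psd 0"
  by (simp add: psd_def transpose_def vec_eq_iff)

lemma psd_sum: "(\<And>k. k \<in> A \<Longrightarrow> psd (f k)) \<Longrightarrow> psd (\<Sum>k\<in>A. f k)"
  by (induction A rule: infinite_finite_induct) (auto simp: psd_zero psd_add)

lemma psd_scaleR: "0 \<le> c \<Longrightarrow> psd A \<Longrightarrow> psd (c *\<^sub>R A)"
  by (auto simp: psd_def transpose_def vec_eq_iff scaleR_matrix_vector_assoc [symmetric])

lemma psd_uminus_iff: "psd (- A) \<longleftrightarrow> nsd A"
proof -
  have "(- A) *v x = - (A *v x)" for x
    by (simp add: matrix_vector_mult_def vec_eq_iff sum_negf)
  then show ?thesis
    by (simp add: psd_def nsd_def) (simp add: transpose_def vec_eq_iff)
qed

lemma rank_one_mult_vec: "(\<chi> i j. v $ i * v $ j) *v x = (v \<bullet> x) *\<^sub>R (v :: real ^ 'n)"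
  by (simp add: matrix_vector_mult_def vec_eq_iff inner_vec_def sum_distrib_left mult_ac)

lemma psd_rank_one: "psd (\<chi> i j. v $ i * (v :: real ^ 'n) $ j)"
  by (simp add: psd_def rank_one_mult_vec transpose_def vec_eq_iff mult.commute inner_commute)

text \<open>The quadratic form of \<open>A\<close> at \<open>x - t *\<^sub>R axis i 1\<close>, where
  symmetry of \<open>A\<close> merges the two cross terms. Different choices of \<open>x\<close> and
  \<open>t\<close> give the diagonal signs, the vanishing rows and the Schur complement bound
  below.\<close>

lemma psd_quadratic_nonneg:
  assumes "psd A"
  shows "0 \<le> x \<bullet> (A *v x) - 2 * t * (A *v x) $ i + t\<^sup>2 * A $ i $ i"
proof -
  have tr: "transpose A = A" using assms by (simp add: psd_def)
  have sym: "x \<bullet> (A *v axis i 1) = (A *v x) $ i"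
    by (metis dot_lmul_matrix inner_axis' inner_commute inner_real_def mult_1
        transpose_matrix_vector tr)
  have diag: "(A *v axis i 1) $ i = A $ i $ i"
    by (simp add: matrix_vector_mult_basis column_def)
  have "0 \<le> (x - t *\<^sub>R axis i 1) \<bullet> (A *v (x - t *\<^sub>R axis i 1))"
    using assms by (simp add: psd_def)
  also have "\<dots> = x \<bullet> (A *v x) - 2 * t * (A *v x) $ i + t\<^sup>2 * A $ i $ i"
    by (simp add: matrix_vector_mult_diff_distrib inner_diff_left inner_diff_right
        matrix_vector_mult_scaleR sym inner_axis' diag power2_eq_square algebra_simps
        del: matrix_vector_mult_basis)
  finally show ?thesis .
qed

lemma psd_diag_nonneg: "psd A \<Longrightarrow> 0 \<le> A $ i $ i"
  using psd_quadratic_nonneg [of A 0 1 i] by simp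

text \<open>When \<open>A $ i $ i = 0\<close>, the quadratic in \<open>t\<close> loses its leading
  term. An affine function of \<open>t\<close> that stays nonnegative on the whole line has slope
  0.\<close>

lemma psd_diag_zero_imp_row_zero:
  assumes "psd A" "A $ i $ i = 0"
  shows "A $ i $ j = 0"
proof -
  let ?x = "axis j 1 :: real ^ _" and ?c = "A $ j $ j"
  have "(A *v ?x) $ i = A $ i $ j" "?x \<bullet> (A *v ?x) = ?c"
    by (simp_all add: matrix_vector_mult_basis column_def inner_axis')
  then have le: "2 * t * A $ i $ j \<le> ?c" for t
    using psd_quadratic_nonneg [OF assms(1), of ?x t i] assms(2) by simp
  show ?thesis
  proof (rule ccontr)
    assume "A $ i $ j \<noteq> 0"
    then show False
      \<comment> \<open>This \<open>t\<close> makes the left side of \<open>le\<close> equal to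
        \<open>?c + 1\<close>.\<close>
      using le [of "(?c + 1) / (2 * A $ i $ j)"] by simp
  qed
qed

text \<open>Symmetric Gaussian elimination: a Schur complement clears one nonzero diagonal entry, and
  zero diagonal entries stay zero because their rows vanish.\<close>

lemma psd_sum_rank_one:
  assumes "psd A"
  shows "\<exists>(r::nat) (v :: nat \<Rightarrow> real ^ 'n). A = (\<Sum>k<r. \<chi> i j. v k $ i * v k $ j)"
  using assms
proof (induction "card {i. A $ i $ i \<noteq> 0}" arbitrary: A rule: less_induct)
  case less
  show ?case
  proof (cases "\<exists>p. A $ p $ p \<noteq> 0")
    case False
    then have "A = 0"
      using psd_diag_zero_imp_row_zero [OF less.prems] by (simp add: vec_eq_iff)
    then show ?thesis
      by (intro exI [of _ 0]) simp
  next
    case True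
    then obtain p where "A $ p $ p \<noteq> 0" by blast
    then have pos: "A $ p $ p > 0"
      using psd_diag_nonneg [OF less.prems, of p] by simp
    have sym: "A $ i $ j = A $ j $ i" for i j
      using less.prems by (simp add: psd_def transpose_def vec_eq_iff)
    \<comment> \<open>Row \<open>p\<close> is scaled so that the outer product of \<open>w\<close>
      with itself agrees with \<open>A\<close> in row and column \<open>p\<close>; subtracting it
      clears both.\<close>
    define w where "w = (1 / sqrt (A $ p $ p)) *\<^sub>R (A $ p)"
    define B where "B = A - (\<chi> i j. w $ i * w $ j)"
    have B_nth: "B $ i $ j = A $ i $ j - A $ p $ i * A $ p $ j / A $ p $ p" for i j
      using pos by (simp add: B_def w_def)
    have "psd B"
      unfolding psd_def
    proof (intro conjI allI)
      show "transpose B = B"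
        using sym by (simp add: transpose_def vec_eq_iff B_nth mult.commute)
      fix x
      have Apx: "(A *v x) $ p = A $ p \<bullet> x"
        by (simp add: matrix_vector_mul_component)
      have "w \<bullet> x = (A *v x) $ p / sqrt (A $ p $ p)"
        by (simp add: w_def Apx)
      then have "(w \<bullet> x)\<^sup>2 = ((A *v x) $ p)\<^sup>2 / A $ p $ p"
        using pos by (simp add: power_divide)
      then have "x \<bullet> (B *v x) = x \<bullet> (A *v x) - ((A *v x) $ p)\<^sup>2 / A $ p $ p"
        by (simp add: B_def matrix_vector_mult_diff_rdistrib inner_diff_right rank_one_mult_vec
            inner_commute power2_eq_square)
      also have "\<dots> \<ge> 0"
        \<comment> \<open>This \<open>t\<close> minimises the quadratic, and the minimum is exactly
          the form of the Schur complement \<open>B\<close> at \<open>x\<close>.\<close>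
        using psd_quadratic_nonneg [OF less.prems, of x "(A *v x) $ p / A $ p $ p" p] pos
        by (simp add: power2_eq_square field_simps)
      finally show "0 \<le> x \<bullet> (B *v x)" .
    qed
    moreover have "card {i. B $ i $ i \<noteq> 0} < card {i. A $ i $ i \<noteq> 0}"
    proof (rule psubset_card_mono)
      have "B $ p $ p = 0"
        using pos by (simp add: B_nth)
      moreover have "B $ i $ i = 0" if "A $ i $ i = 0" for i
        using psd_diag_zero_imp_row_zero [OF less.prems that, of p] sym [of p i] by (simp add: B_nth that)
      ultimately show "{i. B $ i $ i \<noteq> 0} \<subset> {i. A $ i $ i \<noteq> 0}"
        using pos by force
    qed simp
    ultimately obtain r :: nat and v where "B = (\<Sum>k<r. \<chi> i j. v k $ i * v k $ j)"
      using less.hyps by blast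
    \<comment> \<open>The update at \<open>r\<close> appends \<open>w\<close> and leaves the vectors
      with index below \<open>r\<close> unchanged.\<close>
    then have "A = (\<Sum>k<Suc r. \<chi> i j. (v(r := w)) k $ i * (v(r := w)) k $ j)"
      by (simp add: B_def diff_eq_eq)
    then show ?thesis by blast
  qed
qed

section \<open>Sum-of-squares polynomial matrices\<close>

lemma sos_pmat_zero: "sos_pmat 0"
  unfolding sos_pmat_def by (intro exI [of _ 0]) simp

text \<open>The vector \<open>t\<close> becomes one more column of the factor, stored at the first
  free index \<open>q\<close>.\<close>

lemma sos_pmat_add_rank_one:
  assumes "sos_pmat S"
  shows "sos_pmat (S + (\<chi> i j. t i * t j))"
proof -
  obtain q :: nat and T where "S $ i $ j = (\<Sum>k<q. T i k * T j k)" for i j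
    using assms unfolding sos_pmat_def by metis
  then have "(S + (\<chi> i j. t i * t j)) $ i $ j =
      (\<Sum>k<Suc q. ((T i)(q := t i)) k * ((T j)(q := t j)) k)" for i j
    by simp
  then show ?thesis
    unfolding sos_pmat_def by (intro exI [of _ "Suc q"] exI [of _ "\<lambda>i. (T i)(q := t i)"]) blast
qed

text \<open>Writing \<open>A\<close> as a sum of outer products of vectors \<open>v k\<close>, the
  added term is the sum of the outer products of the polynomial columns \<open>p\<close> times
  \<open>v k\<close>.\<close>

lemma sos_pmat_add_psd:
  fixes S :: "('m::finite) rpoly ^ 'n ^ 'n"
  assumes "sos_pmat S" "psd A"
  shows "sos_pmat (S + (\<chi> i j. p * p * const_rpoly (A $ i $ j)))"
proof -
  obtain r :: nat and v where A: "A = (\<Sum>k<r. \<chi> i j. v k $ i * v k $ j)"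
    using psd_sum_rank_one [OF assms(2)] by blast
  have "sos_pmat (S + (\<Sum>k<r. \<chi> i j. (p * const_rpoly (v k $ i)) * (p * const_rpoly (v k $ j))))"
  proof (induction r)
    case 0
    then show ?case using assms(1) by simp
  next
    case (Suc r)
    then show ?case
      using sos_pmat_add_rank_one [OF Suc, of "\<lambda>i. p * const_rpoly (v r $ i)"]
      by (simp add: add.assoc)
  qed
  moreover have "(\<Sum>k<r. \<chi> i j. (p * const_rpoly (v k $ i)) * (p * const_rpoly (v k $ j))) =
      (\<chi> i j. p * p * const_rpoly (A $ i $ j))"
    by (simp add: vec_eq_iff A const_rpoly_sum const_rpoly_mult sum_distrib_left mult_ac)
  ultimately show ?thesis by simp
qed

lemma sos_pmat_add_sum_psd:
  fixes S :: "('m::finite) rpoly ^ 'n ^ 'n"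
  assumes "sos_pmat S" "\<And>k. k \<in> I \<Longrightarrow> psd (A k)"
  shows "sos_pmat (S + (\<Sum>k\<in>I. \<chi> i j. p k * p k * const_rpoly (A k $ i $ j)))"
  using assms(2)
proof (induction I rule: infinite_finite_induct)
  case (insert k I)
  then show ?case
    using sos_pmat_add_psd [of "S + (\<Sum>k\<in>I. \<chi> i j. p k * p k * const_rpoly (A k $ i $ j))" "A k" "p k"]
    by (simp add: add_ac)
qed (use assms(1) in auto)

lemma psd_eval_sos_pmat:
  assumes "sos_pmat S"
  shows "psd (eval_pmat S \<delta>)"
proof -
  obtain q :: nat and T where "S $ i $ j = (\<Sum>k<q. T i k * T j k)" for i j
    using assms unfolding sos_pmat_def by metis
  then have "eval_pmat S \<delta> =
      (\<Sum>k<q. \<chi> i j. (\<chi> i. eval_rpoly (T i k) \<delta>) $ i * (\<chi> i. eval_rpoly (T i k) \<delta>) $ j)"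
    by (simp add: eval_pmat_def vec_eq_iff eval_rpoly_sum eval_rpoly_mult)
  then show ?thesis
    by (simp only:) (intro psd_sum psd_rank_one)
qed

section \<open>Affine pencils on the cube\<close>

text \<open>Expansion of the pencil around the vertex: since \<open>s * s = 1\<close>, the
  coefficient of \<open>H i\<close> in the added sum is \<open>s + \<delta> $ i\<close>, the
  displacement from \<open>- s\<close>.\<close>

lemma affine_pencil_shift:
  fixes s :: real
  assumes "s\<^sup>2 = 1"
  shows "affine_pencil H0 H \<delta> =
    affine_pencil H0 H (\<chi> i. - s) + (\<Sum>i\<in>UNIV. (1 + s * \<delta> $ i) *\<^sub>R (s *\<^sub>R H i))"
proof -
  have "(1 + s * d) * s = s + d" for d
    using assms by (simp add: algebra_simps power2_eq_square)
  then show ?thesis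
    by (simp add: affine_pencil_def scaleR_add_left sum.distrib sum_negf)
qed

lemma psd_affine_pencil_vertex:
  fixes s :: real
  assumes "s\<^sup>2 = 1" "\<And>i. psd (s *\<^sub>R H i)"
    and "psd (affine_pencil H0 H (\<chi> i. - s))" "\<delta> \<in> unit_cube"
  shows "psd (affine_pencil H0 H \<delta>)"
proof -
  have "0 \<le> 1 + s * \<delta> $ i" for i
  proof -
    have "\<bar>s * \<delta> $ i\<bar> \<le> 1"
      using assms(1,4) by (auto simp: unit_cube_def abs_mult power2_eq_1_iff)
    then show ?thesis by linarith
  qed
  then show ?thesis
    unfolding affine_pencil_shift [OF assms(1), of H0 H \<delta>]
    by (intro psd_add psd_sum psd_scaleR assms(2,3))
qed

lemma X3_certificate:
  fixes s :: real and H :: "'m::finite \<Rightarrow> real ^ 'n ^ 'n"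
  assumes s: "s\<^sup>2 = 1" and H: "\<And>i. psd (s *\<^sub>R H i)"
    and vertex: "psd (affine_pencil H0 H (\<chi> i. - s))"
  shows "\<exists>S0 S. (S0, S) \<in> X3 (affine_pencil H0 H)"
proof -
  define P where "P = affine_pencil H0 H (\<chi> i. - s)"
  define K where "K i = (1/2) *\<^sub>R (s *\<^sub>R H i)" for i
  define p :: "'m \<Rightarrow> 'm rpoly" where "p i = const_rpoly 1 + const_rpoly s * var_rpoly i" for i
  define S0 :: "'m rpoly ^ 'n ^ 'n" where
    "S0 = (\<chi> i j. 1 * 1 * const_rpoly (P $ i $ j)) +
      (\<Sum>k\<in>UNIV. \<chi> i j. p k * p k * const_rpoly (K k $ i $ j))"
  have P: "psd P"
    using vertex by (simp add: P_def)
  have K: "psd (K i)" for i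
    unfolding K_def by (rule psd_scaleR [OF _ H]) simp
  have sym: "P $ i $ j = P $ j $ i" "K k $ i $ j = K k $ j $ i" for i j k
    using P K [of k] by (simp_all add: psd_def transpose_def vec_eq_iff)
  have eval_p: "eval_rpoly (p i) \<delta> = 1 + s * \<delta> $ i" for i \<delta>
    by (simp add: p_def eval_rpoly_add eval_rpoly_mult)
  have deg_p: "total_degree_le 1 (p i)" for i
    unfolding p_def
    using total_degree_le_mult [OF total_degree_le_const_rpoly [of 0] total_degree_le_var_rpoly]
    by (intro total_degree_le_add total_degree_le_const_rpoly) simp
  have "total_degree_le (1 + 1 + 0) (p k * p k * const_rpoly c)" for k c
    by (intro total_degree_le_mult deg_p total_degree_le_const_rpoly)
  then have "total_degree_le 2 (S0 $ i $ j)" for i j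
    by (auto simp: S0_def numeral_2_eq_2
        intro!: total_degree_le_add total_degree_le_sum total_degree_le_const_rpoly)
  moreover have "transpose S0 = S0"
    by (auto simp: S0_def transpose_def vec_eq_iff sym)
  moreover have "sos_pmat S0"
    using sos_pmat_add_sum_psd [OF sos_pmat_add_psd [OF sos_pmat_zero P, of 1], of UNIV K p] K
    by (simp add: S0_def)
  moreover have "transpose (K i) = K i" for i
    using K [of i] by (simp add: psd_def)
  moreover have "affine_pencil H0 H \<delta> =
      eval_pmat S0 \<delta> + (\<Sum>i\<in>UNIV. (1 - (\<delta> $ i)\<^sup>2) *\<^sub>R K i)" for \<delta>
  proof -
    have eval_S0: "eval_pmat S0 \<delta> = P + (\<Sum>k\<in>UNIV. (1 + s * \<delta> $ k)\<^sup>2 *\<^sub>R K k)"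
      by (simp add: S0_def eval_pmat_def vec_eq_iff eval_rpoly_add eval_rpoly_sum eval_rpoly_mult
          eval_p power2_eq_square)
    \<comment> \<open>Since \<open>s\<^sup>2 = 1\<close>, the terms in \<open>d\<^sup>2\<close>
      cancel; the remaining factor 2 is absorbed by the 1/2 in \<open>K\<close>.\<close>
    have split: "(1 + s * d)\<^sup>2 + (1 - d\<^sup>2) = (1 + s * d) * 2" for d
      using s by (simp add: power2_sum power_mult_distrib)
    have "(1 + s * d) *\<^sub>R (s *\<^sub>R H i) = (1 + s * d)\<^sup>2 *\<^sub>R K i + (1 - d\<^sup>2) *\<^sub>R K i" for i d
      unfolding scaleR_add_left [symmetric] split by (simp add: K_def)
    then show ?thesis
      using affine_pencil_shift [OF s, of H0 H \<delta>] eval_S0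
      by (simp only: P_def sum.distrib add.assoc)
  qed
  ultimately show ?thesis
    unfolding X3_def by blast
qed

theorem theorem15:
  fixes H0 :: "real ^ 'n ^ 'n"
    and H :: "'m::finite \<Rightarrow> real ^ 'n ^ 'n"
  assumes "transpose H0 = H0"
    and "\<And>i. transpose (H i) = H i"
    and "(\<forall>i. psd (H i)) \<or> (\<forall>i. nsd (H i))"
  shows "(\<forall>\<delta>\<in>unit_cube. psd (affine_pencil H0 H \<delta>)) \<longleftrightarrow>
         (\<exists>S0 S. (S0, S) \<in> X3 (affine_pencil H0 H))"
proof -
  obtain s :: real where s: "s\<^sup>2 = 1" and H: "\<And>i. psd (s *\<^sub>R H i)"
  proof (cases "\<forall>i. psd (H i)")
    case True
    then show ?thesis using that [of 1] by simp
  next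
    case False
    then have "\<forall>i. nsd (H i)" using assms(3) by blast
    then show ?thesis by (intro that [of "- 1"]) (simp_all add: psd_uminus_iff)
  qed
  have vertex: "((\<chi> i. - s) :: real ^ 'm) \<in> unit_cube"
    using s by (auto simp: unit_cube_def power2_eq_1_iff)
  show ?thesis
  proof
    assume "\<forall>\<delta>\<in>unit_cube. psd (affine_pencil H0 H \<delta>)"
    then show "\<exists>S0 S. (S0, S) \<in> X3 (affine_pencil H0 H)"
      using X3_certificate [where H = H, OF s H] vertex by blast
  next
    assume "\<exists>S0 S. (S0, S) \<in> X3 (affine_pencil H0 H)"
    then obtain S0 S where "sos_pmat S0" and
      G: "\<And>\<delta>. affine_pencil H0 H \<delta> = eval_pmat S0 \<delta> + (\<Sum>i\<in>UNIV. (1 - (\<delta> $ i)\<^sup>2) *\<^sub>R S i)"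
      unfolding X3_def by blast
    \<comment> \<open>The matrices \<open>S i\<close> carry no sign condition, so the certificate is
      evaluated only at the vertex, where their coefficients vanish; the monotonicity of the pencil
      covers the rest of the cube.\<close>
    then have "psd (affine_pencil H0 H (\<chi> i. - s))"
      using s by (simp add: G psd_eval_sos_pmat)
    then show "\<forall>\<delta>\<in>unit_cube. psd (affine_pencil H0 H \<delta>)"
      using psd_affine_pencil_vertex [where H = H, OF s H] by blast
  qed
qed

end
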